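(* Let $k\ge 1$ and $n\ge 5$ be integers with $k\le \frac n2$. Every min-saturated convex precolored $\Theta^k$-drawing of a graph $G$ on $n$ vertices contains at most $\frac12(k+4)(n-2)$ edges.
   Context: Graphs are finite and simple. In a straight-line drawing, vertices are distinct points of the plane in general position (no three on a line) and edges are straight-line segments; two edges cross if their relative interiors share a point. A $\Theta^k$-drawing of a graph $G$ is a straight-line drawing $\Gamma$ of $G$ for which there exists an edge-coloring $\varphi\colon E(G)\to\{1,\dots,k\}$ such that no two edges of the same color cross. (Not all colors need to be used.) A precolored $\Theta^k$-drawing is a $\Theta^k$-drawing together with a fixed such coloring $\varphi$. The drawing is convex if its vertices are in convex position. A precolored $\Theta^k$-drawing $\Gamma$ with coloring $\varphi$ is saturated if there are no two distinct vertices $u,v$ with $uv\notin E(G)$ and no color $i\in\{1,\dots,k\}$ such that adding the straight-line edge $uv$ with color $i$ to $\Gamma$ (keeping the colors of all other edges) yields a drawing without monochromatic crossings. A saturated convex precolored $\Theta^k$-drawing is min-saturated if it has the minimum number of edges among all saturated convex precolored $\Theta^k$-drawings on the same number of vertices. *)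

theory Defs
  imports "HOL-Analysis.Analysis"
begin

definition simple_graph :: "'v set \<Rightarrow> 'v set set \<Rightarrow> bool" where
  "simple_graph V E \<longleftrightarrow> finite V \<and> E \<subseteq> {{u, v} | u v. u \<in> V \<and> v \<in> V \<and> u \<noteq> v}"

definition general_position :: "'v set \<Rightarrow> ('v \<Rightarrow> real ^ 2) \<Rightarrow> bool" where
  "general_position V pos \<longleftrightarrow>
     (\<forall>u\<in>V. \<forall>v\<in>V. \<forall>w\<in>V. u \<noteq> v \<and> v \<noteq> w \<and> u \<noteq> w \<longrightarrow> \<not> collinear {pos u, pos v, pos w})"

definition straight_line_drawing ::
    "'v set \<Rightarrow> 'v set set \<Rightarrow> ('v \<Rightarrow> real ^ 2) \<Rightarrow> bool" where
  "straight_line_drawing V E pos \<longleftrightarrow>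
     simple_graph V E \<and> inj_on pos V \<and> general_position V pos"

(* For an edge e = {u, v} this is the closed segment from pos u to pos v. *)
definition edge_segment :: "('v \<Rightarrow> real ^ 2) \<Rightarrow> 'v set \<Rightarrow> (real ^ 2) set" where
  "edge_segment pos e = convex hull (pos ` e)"

definition crosses :: "('v \<Rightarrow> real ^ 2) \<Rightarrow> 'v set \<Rightarrow> 'v set \<Rightarrow> bool" where
  "crosses pos e f \<longleftrightarrow>
     e \<noteq> f \<and> rel_interior (edge_segment pos e) \<inter> rel_interior (edge_segment pos f) \<noteq> {}"

definition no_monochromatic_crossing ::
    "'v set set \<Rightarrow> ('v \<Rightarrow> real ^ 2) \<Rightarrow> ('v set \<Rightarrow> nat) \<Rightarrow> bool" where
  "no_monochromatic_crossing E pos \<phi> \<longleftrightarrow>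
     (\<forall>e\<in>E. \<forall>f\<in>E. \<phi> e = \<phi> f \<longrightarrow> \<not> crosses pos e f)"

(* The values of the coloring outside E are irrelevant. *)
definition precolored_drawing ::
    "nat \<Rightarrow> 'v set \<Rightarrow> 'v set set \<Rightarrow> ('v \<Rightarrow> real ^ 2) \<Rightarrow> ('v set \<Rightarrow> nat) \<Rightarrow> bool" where
  "precolored_drawing k V E pos \<phi> \<longleftrightarrow>
     straight_line_drawing V E pos \<and> \<phi> ` E \<subseteq> {1..k} \<and> no_monochromatic_crossing E pos \<phi>"

definition convex_position :: "'v set \<Rightarrow> ('v \<Rightarrow> real ^ 2) \<Rightarrow> bool" where
  "convex_position V pos \<longleftrightarrow> (\<forall>v\<in>V. pos v \<notin> convex hull (pos ` (V - {v})))"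

definition saturated ::
    "nat \<Rightarrow> 'v set \<Rightarrow> 'v set set \<Rightarrow> ('v \<Rightarrow> real ^ 2) \<Rightarrow> ('v set \<Rightarrow> nat) \<Rightarrow> bool" where
  "saturated k V E pos \<phi> \<longleftrightarrow>
     \<not> (\<exists>u\<in>V. \<exists>v\<in>V. \<exists>i\<in>{1..k}. u \<noteq> v \<and> {u, v} \<notin> E \<and>
          no_monochromatic_crossing (insert {u, v} E) pos (\<phi>({u, v} := i)))"

definition saturated_convex_precolored_drawing ::
    "nat \<Rightarrow> 'v set \<Rightarrow> 'v set set \<Rightarrow> ('v \<Rightarrow> real ^ 2) \<Rightarrow> ('v set \<Rightarrow> nat) \<Rightarrow> bool" where
  "saturated_convex_precolored_drawing k V E pos \<phi> \<longleftrightarrow>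
     precolored_drawing k V E pos \<phi> \<and> convex_position V pos \<and> saturated k V E pos \<phi>"

(* Letting the competitors range over graphs with vertices in the same type 'v loses no
   generality: every graph on card V vertices is isomorphic to one with vertex set V. *)
definition min_saturated ::
    "nat \<Rightarrow> 'v set \<Rightarrow> 'v set set \<Rightarrow> ('v \<Rightarrow> real ^ 2) \<Rightarrow> ('v set \<Rightarrow> nat) \<Rightarrow> bool" where
  "min_saturated k V E pos \<phi> \<longleftrightarrow>
     saturated_convex_precolored_drawing k V E pos \<phi> \<and>
     (\<forall>(V' :: 'v set) E' pos' \<phi>'.
        saturated_convex_precolored_drawing k V' E' pos' \<phi>' \<and> card V' = card V
          \<longrightarrow> card E \<le> card E')"

end

theory Submission
  imports Defs
begin

text \<open>It suffices to exhibit one saturated drawing with few edges. Put the vertices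
  \<open>0, \<dots>, n - 1\<close> on a parabola and sort the edges \<open>{a, b}\<close> into ``parallel classes'' according to
  \<open>(a + b) mod n\<close>. Two crossing edges belong to classes that differ by at least 2 cyclically, and
  conversely a diagonal crosses some edge of every class that is at cyclic distance at least 2 from
  its own. Take the hull edges and \<open>k + 2\<close> consecutive classes \<open>0, \<dots>, k + 1\<close>, where class \<open>i\<close> gets
  color \<open>i\<close>, except that the two extreme classes \<open>0\<close> and \<open>k + 1\<close> get colors \<open>1\<close> and \<open>k\<close>. A missing
  edge then crosses all classes \<open>1, \<dots>, k\<close>. For \<open>k = 1\<close> the two classes \<open>0, 1\<close> are enough.\<close>

section \<open>Points on a parabola and their chords\<close>

definition parabola_point :: "real \<Rightarrow> real ^ 2" where
  "parabola_point t = vector [t, t\<^sup>2]"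

lemma parabola_point_nth [simp]:
  "parabola_point t $ 1 = t" "parabola_point t $ 2 = t\<^sup>2"
  by (simp_all add: parabola_point_def)

lemma parabola_point_eq_iff [simp]: "parabola_point s = parabola_point t \<longleftrightarrow> s = t"
  by (metis parabola_point_nth(1))

text \<open>The tangent at parameter \<open>t\<close> separates: by
  \<open>(s - t)\<^sup>2 > 0\<close> every other point of the parabola lies strictly above
  it.\<close>

lemma parabola_point_notin_hull:
  assumes "t \<notin> S"
  shows "parabola_point t \<notin> convex hull (parabola_point ` S)"
proof
  let ?H = "{z :: real ^ 2. vector [- 2 * t, 1] \<bullet> z > - t\<^sup>2}"
  assume "parabola_point t \<in> convex hull (parabola_point ` S)"
  moreover have "parabola_point ` S \<subseteq> ?H"
  proof clarsimp
    fix s assume "s \<in> S"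
    with assms have "(s - t)\<^sup>2 > 0" by auto
    then show "- t\<^sup>2 < vector [- (2 * t), 1] \<bullet> parabola_point s"
      by (simp add: inner_vec_def sum_2 power2_diff algebra_simps)
  qed
  then have "convex hull (parabola_point ` S) \<subseteq> ?H"
    by (intro hull_minimal convex_halfspace_gt)
  ultimately have "parabola_point t \<in> ?H" by blast
  then show False
    by (simp add: inner_vec_def sum_2 power2_eq_square)
qed

text \<open>Among three collinear points one is between the other two, hence in their convex
  hull.\<close>

lemma not_collinear_parabola_points:
  assumes "a \<noteq> b" "b \<noteq> c" "a \<noteq> c"
  shows "\<not> collinear {parabola_point a, parabola_point b, parabola_point c}"
  using parabola_point_notin_hull[of a "{b, c}"] parabola_point_notin_hull[of b "{c, a}"]
    parabola_point_notin_hull[of c "{a, b}"] assms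
  by (auto simp: collinear_between_cases between_mem_segment segment_convex_hull)

lemma open_parabola_chord:
  assumes "a < b"
  shows "z \<in> open_segment (parabola_point a) (parabola_point b) \<longleftrightarrow>
    a < z $ 1 \<and> z $ 1 < b \<and> z $ 2 = (a + b) * z $ 1 - a * b"
proof
  assume "z \<in> open_segment (parabola_point a) (parabola_point b)"
  then obtain u where u: "0 < u" "u < 1"
    and z: "z = (1 - u) *\<^sub>R parabola_point a + u *\<^sub>R parabola_point b"
    by (auto simp: in_segment)
  have z1: "z $ 1 = a + u * (b - a)" and z2: "z $ 2 = (1 - u) * a\<^sup>2 + u * b\<^sup>2"
    by (simp_all add: z algebra_simps)
  have "0 < u * (b - a)" "0 < (1 - u) * (b - a)" using u assms by simp_all
  then show "a < z $ 1 \<and> z $ 1 < b \<and> z $ 2 = (a + b) * z $ 1 - a * b"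
    unfolding z1 z2 by (simp add: algebra_simps power2_eq_square)
next
  assume z: "a < z $ 1 \<and> z $ 1 < b \<and> z $ 2 = (a + b) * z $ 1 - a * b"
  define u where "u = (z $ 1 - a) / (b - a)"
  have u: "0 < u" "u < 1" using z assms by (auto simp: u_def)
  have z1: "z $ 1 = a + u * (b - a)" using assms by (simp add: u_def)
  have "z $ 2 = (1 - u) * a\<^sup>2 + u * b\<^sup>2"
    using z by (simp add: z1 algebra_simps power2_eq_square)
  with z1 have "z = (1 - u) *\<^sub>R parabola_point a + u *\<^sub>R parabola_point b"
    by (simp add: vec_eq_iff forall_2 algebra_simps)
  with u assms show "z \<in> open_segment (parabola_point a) (parabola_point b)"
    by (auto simp: in_segment)
qed

section \<open>Crossing chords and alternating endpoints\<close>

text \<open>Polymorphic, so that it applies both to vertex labels in \<open>nat\<close> and to their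
  real abscissae.\<close>

definition interleaved :: "'a::linorder \<Rightarrow> 'a \<Rightarrow> 'a \<Rightarrow> 'a \<Rightarrow> bool" where
  "interleaved a b c d \<longleftrightarrow> a < c \<and> c < b \<and> b < d \<or> c < a \<and> a < d \<and> d < b"

lemma interleaved_imp_open_chords_meet:
  assumes "a < c" "c < b" "b < d"
  shows "open_segment (parabola_point a) (parabola_point b) \<inter>
    open_segment (parabola_point c) (parabola_point d) \<noteq> {}"
proof -
  define D where "D = c + d - a - b"
  \<comment> \<open>The abscissa at which the two supporting lines meet; the positive products below
    place it between \<open>c\<close> and \<open>b\<close>.\<close>
  define x where "x = (c * d - a * b) / D"
  have D: "D > 0" using assms by (simp add: D_def)
  have "(c - a) * (b - c) > 0" "(b - c) * (d - b) > 0" using assms by simp_all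
  then have "c * D < c * d - a * b" "c * d - a * b < b * D"
    by (simp_all add: D_def algebra_simps)
  then have x: "c < x" "x < b" using D by (simp_all add: x_def field_simps)
  have "x * D = c * d - a * b" using D by (simp add: x_def)
  then have eq: "(a + b) * x - a * b = (c + d) * x - c * d"
    by (simp add: D_def algebra_simps)
  define z :: "real ^ 2" where "z = vector [x, (a + b) * x - a * b]"
  have z: "z $ 1 = x" "z $ 2 = (a + b) * x - a * b" by (simp_all add: z_def)
  have "z \<in> open_segment (parabola_point a) (parabola_point b)"
    "z \<in> open_segment (parabola_point c) (parabola_point d)"
    using x assms eq by (simp_all add: open_parabola_chord z)
  then show ?thesis by blast
qed

text \<open>Two overlapping intervals that do not interleave are nested, and over the inner one the
  chord of the larger interval runs strictly higher.\<close>

lemma open_chords_meet_imp_interleaved: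
  assumes "a < b" "c < d" "(a, b) \<noteq> (c, d)"
    and "open_segment (parabola_point a) (parabola_point b) \<inter>
      open_segment (parabola_point c) (parabola_point d) \<noteq> {}"
  shows "interleaved a b c d"
proof (rule ccontr)
  obtain z where "z \<in> open_segment (parabola_point a) (parabola_point b)"
    "z \<in> open_segment (parabola_point c) (parabola_point d)"
    using assms(4) by blast
  then obtain x where x: "a < x" "x < b" "c < x" "x < d"
    and eq: "(a + b) * x - a * b = (c + d) * x - c * d"
    using assms by (auto simp: open_parabola_chord)
  txt \<open>Both products are the height of the common point above the parabola.\<close>
  from eq have eq: "(x - a) * (b - x) = (x - c) * (d - x)" by (simp add: algebra_simps)
  have nest: "(x - a') * (b' - x) < (x - c') * (d' - x)"
    if "c' \<le> a'" "b' \<le> d'" "(a', b') \<noteq> (c', d')" "a' < x" "x < b'" for a' b' c' d'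
  proof (cases "c' = a'")
    case True
    with that show ?thesis by (intro mult_le_less_imp_less) auto
  next
    case False
    with that show ?thesis by (intro mult_less_le_imp_less) auto
  qed
  assume "\<not> interleaved a b c d"
  with x consider "c \<le> a" "b \<le> d" | "a \<le> c" "d \<le> b"
    by (fastforce simp: interleaved_def)
  then show False
    using nest[of c a b d] nest[of a c d b] assms(3) x eq by cases auto
qed

lemma open_chords_meet_iff:
  assumes "a < b" "c < d" "(a, b) \<noteq> (c, d)"
  shows "open_segment (parabola_point a) (parabola_point b) \<inter>
    open_segment (parabola_point c) (parabola_point d) \<noteq> {} \<longleftrightarrow> interleaved a b c d"
  using open_chords_meet_imp_interleaved[OF assms]
    interleaved_imp_open_chords_meet[of a c b d] interleaved_imp_open_chords_meet[of c a d b]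
  by (auto simp: interleaved_def Int_commute)

section \<open>Crossings and endpoint sums modulo \<open>n\<close>\<close>

text \<open>Advance \<open>a\<close> by \<open>x\<close> and \<open>b\<close> by \<open>y\<close>
  cyclically, with \<open>x + y = \<delta>\<close>, so that each endpoint moves but stays strictly
  before the other's old position. This is possible because a diagonal has vertices on both
  sides.\<close>

lemma ex_interleaved_sum_mod:
  fixes a b n \<delta> :: nat
  assumes "a < b" "b < n" "2 \<le> \<delta>" "\<delta> + 2 \<le> n" "b \<noteq> Suc a" "\<not> (a = 0 \<and> b = n - 1)"
  obtains c d where "c < d" "d < n" "interleaved a b c d" "(c + d) mod n = (a + b + \<delta>) mod n"
proof -
  define x where "x = min (\<delta> - 1) (b - a - 1)"
  define y where "y = \<delta> - x"
  have xy: "1 \<le> x" "a + x < b" "1 \<le> y" "x + y = \<delta>" "b + y < n + a"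
    using assms by (auto simp: x_def y_def)
  show thesis
  proof (cases "b + y < n")
    case True
    with xy show thesis
      by (intro that[of "a + x" "b + y"]) (auto simp: interleaved_def algebra_simps)
  next
    case False
    \<comment> \<open>Here the advanced \<open>b\<close> wraps around to a label below
      \<open>a\<close> and becomes the smaller endpoint.\<close>
    have "(b + y - n + (a + x)) mod n = (b + y - n + (a + x) + n) mod n"
      by (rule mod_add_self2[symmetric])
    also have "b + y - n + (a + x) + n = a + b + \<delta>" using False xy by simp
    finally show thesis
      using False xy assms by (intro that[of "b + y - n" "a + x"]) (auto simp: interleaved_def)
  qed
qed

text \<open>Both \<open>c - a\<close> and \<open>d - b\<close> are positive, and their sum is
  \<open>(d - a) - (b - c)\<close>, at most \<open>(n - 1) - 1\<close>.\<close>

lemma interleaved_sum_diff: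
  fixes a b c d n :: nat
  assumes "a < c" "c < b" "b < d" "d < n"
  obtains \<delta> where "c + d = a + b + \<delta>" "2 \<le> \<delta>" "\<delta> + 2 \<le> n"
  using assms by (intro that[of "c + d - (a + b)"]) auto

text \<open>The residue either rises by \<open>\<delta>\<close> or falls by
  \<open>n - \<delta>\<close>, and both amounts are at least 2.\<close>

lemma shifted_mod_far:
  fixes s \<delta> n :: nat
  assumes "2 \<le> \<delta>" "\<delta> + 2 \<le> n"
  shows "(s + \<delta>) mod n \<ge> s mod n + 2 \<or> s mod n \<ge> (s + \<delta>) mod n + 2"
proof -
  have less: "s mod n < n" using assms by simp
  have eq: "(s + \<delta>) mod n = (s mod n + \<delta>) mod n" by (simp add: mod_add_left_eq)
  show ?thesis
  proof (cases "s mod n + \<delta> < n")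
    case True
    then show ?thesis using eq assms by simp
  next
    case False
    moreover have "s mod n + \<delta> - n < n" using less assms by linarith
    ultimately have "(s mod n + \<delta>) mod n = s mod n + \<delta> - n"
      by (simp add: le_mod_geq)
    then show ?thesis using eq assms False by linarith
  qed
qed

section \<open>Counting the edges of the construction\<close>

definition hull_pairs :: "nat \<Rightarrow> (nat \<times> nat) set" where
  "hull_pairs n = insert (0, n - 1) ((\<lambda>a. (a, Suc a)) ` {..<n - 1})"

text \<open>In a regular \<open>n\<close>-gon with cyclic labels these would be the chords of one
  direction.\<close>

definition class_pairs :: "nat \<Rightarrow> nat \<Rightarrow> (nat \<times> nat) set" where
  "class_pairs n r = {(a, b). a < b \<and> b < n \<and> (a + b) mod n = r}"

lemma card_hull_pairs: "n \<ge> 1 \<Longrightarrow> card (hull_pairs n) \<le> n"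
  using card_image_le[of "{..<n - 1}" "\<lambda>a. (a, Suc a)"]
    card_insert_le_m1[of n "(\<lambda>a. (a, Suc a)) ` {..<n - 1}" "(0, n - 1)"]
  by (simp add: hull_pairs_def)

text \<open>The sum \<open>a + b\<close> is \<open>r\<close> or \<open>r + n\<close>, and
  \<open>b \<ge> a + 2\<close> off the hull. In the second case \<open>b < n\<close> forces
  \<open>a > r\<close>. The two summands count the remaining choices of \<open>a\<close>.\<close>

lemma card_class_diagonals:
  assumes "r < n"
  shows "card (class_pairs n r - hull_pairs n) \<le> r div 2 + ((r + n) div 2 - (r + 1))"
proof -
  have "class_pairs n r - hull_pairs n \<subseteq>
    (\<lambda>a. (a, r - a)) ` {..<r div 2} \<union> (\<lambda>a. (a, r + n - a)) ` {r + 1..<(r + n) div 2}"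
    (is "_ \<subseteq> ?A \<union> ?B")
  proof
    fix e assume e: "e \<in> class_pairs n r - hull_pairs n"
    obtain a b where ab: "e = (a, b)" by (cases e)
    have *: "a < b" "b < n" "(a + b) mod n = r" using e ab by (auto simp: class_pairs_def)
    have "(a, b) \<notin> (\<lambda>a. (a, Suc a)) ` {..<n - 1}" using e ab by (simp add: hull_pairs_def)
    with *(1,2) have "b \<noteq> Suc a" by auto
    with * have b: "a + 2 \<le> b" by simp
    show "e \<in> ?A \<union> ?B"
    proof (cases "a + b < n")
      case True
      with * have "a + b = r" by simp
      with b have "e \<in> ?A" by (auto simp: ab image_iff)
      then show ?thesis ..
    next
      case False
      with * have "a + b - n = r" by (simp add: le_mod_geq)
      with False have "a + b = r + n" by simp
      with b *(2) have "e \<in> ?B" by (auto simp: ab image_iff)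
      then show ?thesis ..
    qed
  qed
  then have "card (class_pairs n r - hull_pairs n) \<le> card (?A \<union> ?B)"
    by (rule card_mono[rotated]) simp
  also have "\<dots> \<le> card ?A + card ?B" by (rule card_Un_le)
  also have "\<dots> \<le> r div 2 + ((r + n) div 2 - (r + 1))"
    by (intro add_mono order_trans[OF card_image_le]) simp_all
  finally show ?thesis .
qed

text \<open>The bounds for two neighbouring classes add up to exactly \<open>n - 3\<close>, hence
  the induction in steps of two; \<open>m mod 2\<close> pays for an unpaired class.\<close>

lemma card_consecutive_class_diagonals:
  assumes "m < n"
  shows "2 * card ((\<Union>r<m. class_pairs n r) - hull_pairs n) \<le> m * (n - 3) + m mod 2"
proof -
  let ?f = "\<lambda>r. r div 2 + ((r + n) div 2 - (r + 1))"
  have sum: "2 * (\<Sum>r<m. ?f r) \<le> m * (n - 3) + m mod 2"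
    using assms
  proof (induction m rule: induct_nat_012)
    case (ge2 m)
    have half: "x div 2 + Suc x div 2 = x" for x :: nat by presburger
    \<comment> \<open>These inequalities keep the natural subtractions in \<open>?f\<close> from
      truncating.\<close>
    have "m + 1 \<le> (m + n) div 2" "Suc m + 1 \<le> (Suc m + n) div 2" using ge2.prems by auto
    then have "?f m + ?f (Suc m) = n - 3" 
      using half[of m] half[of "m + n"] unfolding add_Suc by linarith
    moreover have "2 * (\<Sum>r<m. ?f r) \<le> m * (n - 3) + m mod 2" using ge2 by simp
    moreover have "(\<Sum>r<Suc (Suc m). ?f r) = (\<Sum>r<m. ?f r) + (?f m + ?f (Suc m))"
      by (simp only: sum.lessThan_Suc add.assoc)
    moreover have "Suc (Suc m) * (n - 3) = m * (n - 3) + 2 * (n - 3)" by simp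
    moreover have "Suc (Suc m) mod 2 = m mod 2" by simp
    ultimately show ?case by linarith
  qed auto
  have "card ((\<Union>r<m. class_pairs n r) - hull_pairs n)
      = card (\<Union>r<m. class_pairs n r - hull_pairs n)"
    by (rule arg_cong[of _ _ card]) blast
  also have "\<dots> \<le> (\<Sum>r<m. card (class_pairs n r - hull_pairs n))"
    by (rule card_UN_le) simp
  also have "\<dots> \<le> (\<Sum>r<m. ?f r)"
    using assms by (intro sum_mono card_class_diagonals) auto
  finally show ?thesis using sum by linarith
qed

definition drawing_pairs :: "nat \<Rightarrow> nat \<Rightarrow> (nat \<times> nat) set" where
  "drawing_pairs n m = hull_pairs n \<union> (\<Union>r<m. class_pairs n r)"

lemma drawing_pairs_less: "n \<ge> 2 \<Longrightarrow> (a, b) \<in> drawing_pairs n m \<Longrightarrow> a < b \<and> b < n"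
  by (auto simp: drawing_pairs_def hull_pairs_def class_pairs_def)

lemma finite_drawing_pairs: "n \<ge> 2 \<Longrightarrow> finite (drawing_pairs n m)"
  by (rule finite_subset[of _ "{..<n} \<times> {..<n}"]) (auto dest: drawing_pairs_less)

lemma card_drawing_pairs:
  assumes "1 \<le> m" "m < n"
  shows "2 * card (drawing_pairs n m) \<le> 2 * n + m * (n - 3) + m mod 2"
proof -
  have "card (drawing_pairs n m) \<le>
      card (hull_pairs n) + card ((\<Union>r<m. class_pairs n r) - hull_pairs n)"
    unfolding drawing_pairs_def by (metis Un_Diff_cancel card_Un_le)
  then show ?thesis
    using card_hull_pairs[of n] card_consecutive_class_diagonals[of m n] assms by linarith
qed

text \<open>Hull edges cross nothing, so both pairs must come from the selected classes.\<close>

lemma interleaved_drawing_pairs_class: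
  assumes "(a, b) \<in> drawing_pairs n m" "(c, d) \<in> drawing_pairs n m"
    and "a < c" "c < b" "b < d" "d < n"
  shows "(a + b) mod n < m \<and> (c + d) mod n < m"
  using assms by (auto simp: drawing_pairs_def hull_pairs_def class_pairs_def)

section \<open>The saturated drawing\<close>

lemma ex_saturated_drawing:
  fixes V :: "'v set"
  assumes "1 \<le> k" "5 \<le> n" "2 * k \<le> n" "card V = n"
  obtains E :: "'v set set" and pos \<phi>
  where "saturated_convex_precolored_drawing k V E pos \<phi>"
    and "2 * card E \<le> (k + 4) * (n - 2)"
proof -
  \<comment> \<open>The number of classes. For \<open>k = 1\<close>, three classes would all receive
    color 1 although classes 0 and 2 can cross.\<close>
  define m where "m = (if k = 1 then 2 else k + 2)"
  have m: "2 \<le> m" "m < n" "m \<le> k + 2" "k < m" using assms by (auto simp: m_def)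
  have finV: "finite V" using assms by (auto intro: card_ge_0_finite)
  obtain p where p: "bij_betw p {..<n} V"
    using ex_bij_betw_nat_finite[OF finV] assms(4) by (auto simp: atLeast0LessThan)
  define h where "h = inv_into {..<n} p"
  have h_p: "h (p a) = a" if "a < n" for a
    using p that by (simp add: h_def bij_betw_inv_into_left)
  have p_V: "p a \<in> V" if "a < n" for a
    using p that by (auto simp: bij_betw_def)
  have V_p: "\<exists>a<n. v = p a" if "v \<in> V" for v
    using p that by (auto simp: bij_betw_def)
  have p_eq: "p a = p b \<longleftrightarrow> a = b" if "a < n" "b < n" for a b
    using h_p that by metis
  define pos where "pos = (\<lambda>v. parabola_point (real (h v)))"
  define edge where "edge = (\<lambda>(a, b). {p a, p b})"
  define E where "E = edge ` drawing_pairs n m"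
  \<comment> \<open>Clamping the class to \<open>{1..k}\<close> merges class 0 into color 1 and
    class \<open>k + 1\<close> into color \<open>k\<close>. Hull edges outside the chosen classes
    also get a legal color, and they cross nothing.\<close>
  define \<phi> where "\<phi> = (\<lambda>e. max 1 (min k (sum h e mod n)))"
  have edge_eq: "edge (a, b) = edge (c, d) \<longleftrightarrow> a = c \<and> b = d"
    if "a < b" "b < n" "c < d" "d < n" for a b c d
    using that by (auto simp: edge_def doubleton_eq_iff p_eq)
  have \<phi>_edge: "\<phi> (edge (a, b)) = max 1 (min k ((a + b) mod n))" if "a < b" "b < n" for a b
    using that by (simp add: \<phi>_def edge_def h_p p_eq)
  have crosses: "crosses pos (edge (a, b)) (edge (c, d)) \<longleftrightarrow> interleaved a b c d"
    if "a < b" "b < n" "c < d" "d < n" for a b c d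
  proof (cases "(a, b) = (c, d)")
    case True
    then show ?thesis by (auto simp: crosses_def interleaved_def)
  next
    case False
    have seg: "rel_interior (edge_segment pos (edge (a', b'))) =
        open_segment (parabola_point (real a')) (parabola_point (real b'))"
      if "a' < b'" "b' < n" for a' b'
      using that by (simp add: edge_segment_def edge_def pos_def h_p
          rel_interior_closed_segment flip: segment_convex_hull)
    show ?thesis
      using False that open_chords_meet_iff[of "real a" "real b" "real c" "real d"]
      by (simp add: crosses_def seg edge_eq) (simp add: interleaved_def)
  qed
  have inj: "inj_on h V"
    using V_p h_p by (metis inj_onI)
  have convex: "convex_position V pos"
    unfolding convex_position_def
  proof
    fix v assume "v \<in> V"
    then have "real (h v) \<notin> (\<lambda>w. real (h w)) ` (V - {v})"
      using inj by (auto dest: inj_onD)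
    then show "pos v \<notin> convex hull (pos ` (V - {v}))"
      using parabola_point_notin_hull unfolding pos_def by (metis image_image)
  qed
  have less: "a < b \<and> b < n" if "(a, b) \<in> drawing_pairs n m" for a b
    using drawing_pairs_less[of n a b m] that assms(2) by simp
  have drawing: "straight_line_drawing V E pos"
    unfolding straight_line_drawing_def
  proof (intro conjI)
    show "simple_graph V E"
      unfolding simple_graph_def E_def edge_def
    proof (intro conjI finV subsetI, clarify)
      fix a b assume "(a, b) \<in> drawing_pairs n m"
      then have "a < b" "b < n" using less by auto
      then have "p a \<in> V" "p b \<in> V" "p a \<noteq> p b" by (simp_all add: p_V p_eq)
      then show "\<exists>u v. {p a, p b} = {u, v} \<and> u \<in> V \<and> v \<in> V \<and> u \<noteq> v" by blast
    qed
    show "inj_on pos V" using inj by (auto simp: inj_on_def pos_def)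
    show "general_position V pos"
      unfolding general_position_def pos_def
      by (intro ballI impI not_collinear_parabola_points) (use inj in \<open>auto dest: inj_onD\<close>)
  qed
  have no_mono: "False"
    if ab: "(a, b) \<in> drawing_pairs n m" and cd: "(c, d) \<in> drawing_pairs n m"
      and lt: "a < c" "c < b" "b < d" and col: "\<phi> (edge (a, b)) = \<phi> (edge (c, d))" for a b c d
  proof -
    have "d < n" using less cd by blast
    with lt obtain \<delta> where "c + d = a + b + \<delta>" "2 \<le> \<delta>" "\<delta> + 2 \<le> n"
      using interleaved_sum_diff by blast
    then have "(c + d) mod n \<ge> (a + b) mod n + 2 \<or> (a + b) mod n \<ge> (c + d) mod n + 2"
      using shifted_mod_far by metis
    moreover have "(a + b) mod n < m \<and> (c + d) mod n < m"
      using interleaved_drawing_pairs_class[OF ab cd lt \<open>d < n\<close>] .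
    moreover have "max 1 (min k ((a + b) mod n)) = max 1 (min k ((c + d) mod n))"
      using col less[OF ab] less[OF cd] by (simp add: \<phi>_edge)
    \<comment> \<open>Below \<open>m\<close>, clamping identifies only classes that differ by at
      most 1.\<close>
    ultimately show False
      by (auto simp: m_def max_def min_def split: if_splits)
  qed
  have precolored: "precolored_drawing k V E pos \<phi>"
    unfolding precolored_drawing_def
  proof (intro conjI drawing)
    show "\<phi> ` E \<subseteq> {1..k}" using assms(1) by (auto simp: \<phi>_def)
    show "no_monochromatic_crossing E pos \<phi>"
      unfolding no_monochromatic_crossing_def E_def
    proof (intro ballI impI notI, clarify)
      fix a b c d
      assume ab: "(a, b) \<in> drawing_pairs n m" and cd: "(c, d) \<in> drawing_pairs n m"
        and col: "\<phi> (edge (a, b)) = \<phi> (edge (c, d))"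
        and cr: "crosses pos (edge (a, b)) (edge (c, d))"
      have "interleaved a b c d" using cr crosses less[OF ab] less[OF cd] by blast
      then show False
        using no_mono[OF ab cd _ _ _ col] no_mono[OF cd ab _ _ _ col[symmetric]]
        by (auto simp: interleaved_def)
    qed
  qed
  have blocked: "\<exists>e\<in>E. \<phi> e = i \<and> e \<noteq> edge (a, b) \<and> crosses pos (edge (a, b)) e"
    if ab: "a < b" "b < n" "edge (a, b) \<notin> E" and i: "i \<in> {1..k}" for a b i
  proof -
    have "(a, b) \<notin> drawing_pairs n m" using ab by (auto simp: E_def)
    then have hull: "b \<noteq> Suc a" "\<not> (a = 0 \<and> b = n - 1)" and "m \<le> (a + b) mod n"
      using ab by (auto simp: drawing_pairs_def hull_pairs_def class_pairs_def image_iff)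
    define s where "s = (a + b) mod n"
    have s: "m \<le> s" using \<open>m \<le> (a + b) mod n\<close> by (simp add: s_def)
    txt \<open>For \<open>k = 1\<close> the edges of class 2 need not cross class 1, but then they cross class 0.\<close>
    define t where "t = (if k = 1 \<and> s = 2 then 0 else i)"
    have sn: "s < n" using assms by (simp add: s_def)
    \<comment> \<open>The first two facts say that \<open>s\<close> and \<open>t\<close> are at
      cyclic distance at least 2; for \<open>k \<ge> 2\<close> the extreme classes 0 and
      \<open>k + 1\<close> serve as the buffer that guarantees this.\<close>
    have t: "t + 2 \<le> s" "s + 2 \<le> n + t" "t < m" "max 1 (min k t) = i"
      using s sn i assms m by (auto simp: t_def m_def split: if_splits)
    \<comment> \<open>The shift \<open>n + t - s\<close> leads from class \<open>s\<close> to class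
      \<open>t\<close> modulo \<open>n\<close>.\<close>
    have "2 \<le> n + t - s" "n + t - s + 2 \<le> n" using t sn by linarith+
    then obtain c d where cd: "c < d" "d < n" "interleaved a b c d"
      and mod: "(c + d) mod n = (a + b + (n + t - s)) mod n"
      using ex_interleaved_sum_mod[OF ab(1,2) _ _ hull] by blast
    have "(a + b + (n + t - s)) mod n = (s + (n + t - s)) mod n"
      unfolding s_def by (simp add: mod_add_left_eq)
    also have "\<dots> = t" using sn t m by simp
    finally have cls: "(c + d) mod n = t" using mod by simp
    then have "(c, d) \<in> drawing_pairs n m"
      using cd t by (auto simp: drawing_pairs_def class_pairs_def)
    then have "edge (c, d) \<in> E" by (simp add: E_def)
    moreover have "\<phi> (edge (c, d)) = i" using cd cls t by (simp add: \<phi>_edge)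
    moreover have "crosses pos (edge (a, b)) (edge (c, d))" using crosses ab cd by simp
    moreover have "edge (c, d) \<noteq> edge (a, b)" using \<open>edge (c, d) \<in> E\<close> ab by auto
    ultimately show ?thesis by blast
  qed
  have "saturated k V E pos \<phi>"
    unfolding saturated_def
  proof clarify
    fix u v i
    assume uv: "u \<in> V" "v \<in> V" "u \<noteq> v" "{u, v} \<notin> E" and i: "i \<in> {1..k}"
      and nm: "no_monochromatic_crossing (insert {u, v} E) pos (\<phi>({u, v} := i))"
    obtain a b where ab: "a < b" "b < n" "{u, v} = edge (a, b)"
      using V_p[OF uv(1)] V_p[OF uv(2)] uv(3)
      by (metis case_prod_conv edge_def insert_commute linorder_neqE_nat)
    \<comment> \<open>As \<open>e\<close> differs from \<open>{u, v}\<close>, it keeps color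
      \<open>i\<close> in the updated coloring.\<close>
    then obtain e where "e \<in> E" "\<phi> e = i" "e \<noteq> {u, v}" "crosses pos {u, v} e"
      using blocked i uv(4) by metis
    then show False using nm by (auto simp: no_monochromatic_crossing_def)
  qed
  then have sat: "saturated_convex_precolored_drawing k V E pos \<phi>"
    using precolored convex by (simp add: saturated_convex_precolored_drawing_def)
  have "2 * card E \<le> 2 * card (drawing_pairs n m)"
    using finite_drawing_pairs[of n m] assms(2) by (auto simp: E_def intro: card_image_le)
  also have "\<dots> \<le> 2 * n + m * (n - 3) + m mod 2" using card_drawing_pairs m by simp
  also have "\<dots> \<le> (k + 4) * (n - 2)"
  proof -
    obtain l where l: "n = l + 5" using assms(2) by (metis add.commute le_Suc_ex)
    \<comment> \<open>For \<open>k \<ge> 2\<close> the inequality amounts to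
      \<open>2 + k mod 2 \<le> k\<close>, which is tight at \<open>k = 2\<close> and
      \<open>k = 3\<close>.\<close>
    consider "k = 1" | "k = 2" | "k \<ge> 3" using assms(1) by linarith
    then show ?thesis
      by cases (simp_all add: m_def l algebra_simps)
  qed
  finally show thesis using that sat by blast
qed

theorem proposition2p3:
  fixes k n :: nat
    and V :: "'v set" and E :: "'v set set"
    and pos :: "'v \<Rightarrow> real ^ 2" and \<phi> :: "'v set \<Rightarrow> nat"
  assumes "k \<ge> 1" and "n \<ge> 5" and "real k \<le> real n / 2"
    and "card V = n"
    and "min_saturated k V E pos \<phi>"
  shows "real (card E) \<le> 1 / 2 * (real k + 4) * (real n - 2)"
proof -
  have "2 * k \<le> n" using assms(3) by linarith
  then obtain E' :: "'v set set" and pos' \<phi>'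
    where sat: "saturated_convex_precolored_drawing k V E' pos' \<phi>'"
      and le: "2 * card E' \<le> (k + 4) * (n - 2)"
    using ex_saturated_drawing assms(1,2,4) by blast
  have "card E \<le> card E'" using assms(5) sat by (auto simp: min_saturated_def)
  with le have "2 * card E \<le> (k + 4) * (n - 2)" by linarith
  then have "real (2 * card E) \<le> real ((k + 4) * (n - 2))" by (simp only: of_nat_le_iff)
  then show ?thesis using assms(2) by (simp add: of_nat_diff)
qed

end
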